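(* Let $r,d\ge0$ be integers. The limit as $n\to\infty$ of the probability that the $r$th vertex in a random path in $\mathcal D_n$ has height $d$ exists. Denoting this limit by $p_{r,d}$, we have $$\sum_{r\ge0}\sum_{d\ge0} p_{r,d}\, x^r y^d = \frac{2}{1+y^2-2xy+(1-y^2)\sqrt{1-x^2}}.$$
   Context: A Dyck path of semilength $n$ is a lattice path in $\mathbb Z^2$ with steps $(1,1)$ and $(1,-1)$ that starts at $(0,0)$, ends at $(2n,0)$, and never goes below the $x$-axis; $\mathcal D_n$ is the set of these. The vertices of a path in $\mathcal D_n$ are indexed $0,1,\dots,2n$ from left to right, so the $r$th vertex is the one with $x$-coordinate $r$; its height is its $y$-coordinate. A random path is chosen uniformly from $\mathcal D_n$ (with $2n\ge r$). The identity is one of formal power series in $x,y$. *)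

theory Defs
  imports
    "HOL-Probability.Probability"
    "HOL-Computational_Algebra.Formal_Power_Series"
    "HOL-Library.Product_Plus"
begin

text \<open>
  A lattice path is represented by the list of its vertices in \<open>\<int>\<^sup>2\<close>, so that the vertex with
  index \<open>r\<close> is \<open>P ! r\<close>.  The endpoint conditions force such a list to have length \<open>2 * n + 1\<close>.
\<close>

definition dyck_paths :: "nat \<Rightarrow> (int \<times> int) list set" where
  "dyck_paths n = {P. P \<noteq> [] \<and> hd P = (0, 0) \<and> last P = (2 * int n, 0) \<and>
     (\<forall>i. Suc i < length P \<longrightarrow> P ! Suc i - P ! i \<in> {(1, 1), (1, -1)}) \<and>
     (\<forall>v \<in> set P. 0 \<le> snd v)}"

lemma dyck_paths_fst_nth:
  assumes "P \<in> dyck_paths n" "r < length P"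
  shows "fst (P ! r) = int r"
  using assms(2)
proof (induction r)
  case 0
  then show ?case using assms(1) by (simp add: dyck_paths_def hd_conv_nth)
next
  case (Suc r)
  have "P ! Suc r - P ! r \<in> {(1, 1), (1, -1)}"
    using assms(1) Suc.prems by (simp add: dyck_paths_def)
  hence "fst (P ! Suc r - P ! r) = 1" by (elim insertE emptyE) (simp_all only: fst_conv)
  then show ?case using Suc by simp
qed

lemma dyck_paths_length:
  assumes "P \<in> dyck_paths n"
  shows "length P = 2 * n + 1"
proof -
  have ne: "P \<noteq> []" and "last P = (2 * int n, 0)" using assms by (auto simp: dyck_paths_def)
  hence "fst (P ! (length P - 1)) = 2 * int n" by (simp add: last_conv_nth)
  moreover have "fst (P ! (length P - 1)) = int (length P - 1)"
    using dyck_paths_fst_nth[OF assms] ne by simp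
  ultimately have "length P - 1 = 2 * n" by linarith
  moreover have "length P > 0" using ne by simp
  ultimately show ?thesis by linarith
qed

lemma dyck_paths_snd_nth_le:
  assumes "P \<in> dyck_paths n" "r < length P"
  shows "snd (P ! r) \<le> int r"
  using assms(2)
proof (induction r)
  case 0
  then show ?case using assms(1) by (simp add: dyck_paths_def hd_conv_nth)
next
  case (Suc r)
  have "P ! Suc r - P ! r \<in> {(1, 1), (1, -1)}"
    using assms(1) Suc.prems by (simp add: dyck_paths_def)
  hence "snd (P ! Suc r - P ! r) \<le> 1" by (elim insertE emptyE) (simp_all only: snd_conv order_refl, simp_all?)
  then show ?case using Suc by simp
qed

lemma finite_dyck_paths: "finite (dyck_paths n)"
proof -
  define B where "B = {0..2 * int n} \<times> {0..2 * int n}"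
  have "v \<in> B" if P: "P \<in> dyck_paths n" and v: "v \<in> set P" for P v
  proof -
    obtain r where r: "r < length P" "P ! r = v" using v unfolding in_set_conv_nth by blast
    have "0 \<le> snd v" using P v unfolding dyck_paths_def by blast
    moreover have "fst v = int r" "snd v \<le> int r"
      using dyck_paths_fst_nth[OF P r(1)] dyck_paths_snd_nth_le[OF P r(1)] unfolding r(2) .
    moreover have "r \<le> 2 * n" using r(1) dyck_paths_length[OF P] by linarith
    ultimately show ?thesis unfolding B_def mem_Times_iff atLeastAtMost_iff by linarith
  qed
  hence "dyck_paths n \<subseteq> {P. set P \<subseteq> B \<and> length P = 2 * n + 1}"
    using dyck_paths_length by blast
  moreover have "finite B" unfolding B_def by (intro finite_cartesian_product finite_atLeastAtMost_int)
  hence "finite {P. set P \<subseteq> B \<and> length P = 2 * n + 1}" by (rule finite_lists_length_eq)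
  ultimately show ?thesis by (rule finite_subset)
qed

lemma dyck_paths_nonempty: "dyck_paths n \<noteq> {}"
proof -
  let ?P = "map (\<lambda>i. (int i, int (i mod 2))) [0..<2 * n + 1]"
  have hd: "hd ?P = (0, 0)"
    using hd_conv_nth[of ?P] by (simp del: upt_Suc)
  have last: "last ?P = (2 * int n, 0)"
    using last_conv_nth[of ?P] by (simp del: upt_Suc)
  have step: "?P ! Suc i - ?P ! i \<in> {(1, 1), (1, -1)}" if "Suc i < length ?P" for i
  proof -
    have "?P ! Suc i = (int (Suc i), int (Suc i mod 2))" "?P ! i = (int i, int (i mod 2))"
      using that by (simp_all del: upt_Suc)
    moreover have "i mod 2 = 0 \<and> Suc i mod 2 = 1 \<or> i mod 2 = 1 \<and> Suc i mod 2 = 0"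
      by presburger
    ultimately show ?thesis by auto
  qed
  have "?P \<noteq> []" by simp
  moreover have "\<forall>v \<in> set ?P. 0 \<le> snd v" by auto
  ultimately have "?P \<in> dyck_paths n"
    unfolding dyck_paths_def using hd last step by blast
  thus ?thesis by blast
qed

text \<open>
  The probability that vertex \<open>r\<close> of a uniformly random path in \<open>dyck_paths n\<close> has height \<open>d\<close>.  It
  is meaningful for \<open>r \<le> 2 * n\<close> only; for fixed \<open>r\<close> the finitely many other values of \<open>n\<close> do not
  affect the limit.
\<close>

definition height_prob :: "nat \<Rightarrow> nat \<Rightarrow> nat \<Rightarrow> real" where
  "height_prob n r d =
     measure_pmf.prob (pmf_of_set (dyck_paths n)) {P. snd (P ! r) = int d}"

definition limit_prob :: "nat \<Rightarrow> nat \<Rightarrow> real" where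
  "limit_prob r d = lim (\<lambda>n. height_prob n r d)"

text \<open>
  The ring of power series in \<open>x\<close> and \<open>y\<close> is \<^typ>\<open>real fps fps\<close>: the outer variable is \<open>y\<close>, the
  inner one is \<open>x\<close>.  Hence the coefficient of \<open>x^r y^d\<close> in \<open>F\<close> is \<open>fps_nth (fps_nth F d) r\<close>.
\<close>

definition var_x :: "real fps fps" where
  "var_x = fps_const fps_X"

definition var_y :: "real fps fps" where
  "var_y = fps_X"

definition bivariate_gf :: "(nat \<Rightarrow> nat \<Rightarrow> real) \<Rightarrow> real fps fps" where
  "bivariate_gf p = Abs_fps (\<lambda>d. Abs_fps (\<lambda>r. p r d))"

text \<open>The square root of \<open>1 - x^2\<close> with constant term \<open>1\<close>.\<close>

definition sqrt_one_minus_x2 :: "real fps fps" where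
  "sqrt_one_minus_x2 = fps_const (fps_radical root 2 (1 - fps_X ^ 2))"

lemma sqrt_one_minus_x2_square: "sqrt_one_minus_x2 ^ 2 = 1 - var_x ^ 2"
proof -
  have "fps_radical root 2 (1 - fps_X ^ 2 :: real fps) ^ 2 = 1 - fps_X ^ 2"
  proof -
    have "root (Suc 1) (fps_nth (1 - fps_X ^ 2 :: real fps) 0) ^ Suc 1
        = fps_nth (1 - fps_X ^ 2 :: real fps) 0"
      by simp
    with power_radical[of "1 - fps_X ^ 2 :: real fps" root 1] show ?thesis
      unfolding Suc_1 by force
  qed
  hence "sqrt_one_minus_x2 ^ 2 = fps_const (1 - fps_X ^ 2)"
    unfolding sqrt_one_minus_x2_def fps_const_power by simp
  also have "\<dots> = fps_const 1 - fps_const fps_X ^ 2"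
    by (simp only: fps_const_sub fps_const_power)
  finally show ?thesis by (simp add: var_x_def)
qed

text \<open>
  In the denominator of the generating function the constant term with respect to \<open>y\<close> is a unit
  of \<^typ>\<open>real fps\<close>, so the quotient is a genuine one.
\<close>

lemma denominator_divides:
  fixes D :: "real fps fps"
  defines "D \<equiv> 1 + var_y ^ 2 - 2 * var_x * var_y + (1 - var_y ^ 2) * sqrt_one_minus_x2"
  shows "D * (2 / D) = 2"
proof -
  let ?s = "fps_radical root 2 (1 - fps_X ^ 2 :: real fps)"
  have D0: "fps_nth D 0 = 1 + ?s"
    by (simp add: D_def var_x_def var_y_def sqrt_one_minus_x2_def)
  have "fps_nth (1 + ?s) 0 \<noteq> 0" by simp
  hence inv: "fps_nth D 0 * inverse (fps_nth D 0) = 1"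
    unfolding D0 by (metis inverse_mult_eq_1 mult.commute)
  hence sub: "subdegree D = 0" by (intro subdegree_eq_0) auto
  have "D * inverse D = 1"
    by (subst fps_inverse_def) (rule fps_right_inverse[OF inv])
  moreover have "2 / D = 2 * inverse D"
    by (simp add: fps_divide_def sub)
  ultimately show ?thesis by (metis mult.left_commute mult.right_neutral)
qed

end

theory Submission
  imports Defs "HOL-Real_Asymp.Real_Asymp"
begin

text \<open>
  Let \<open>W m b d\<close> be the number of walks with \<open>m\<close> steps \<open>\<plusminus>1\<close> from height \<open>b\<close> to height \<open>d\<close> that stay
  nonnegative (\<open>walk_count\<close>).  Cutting a Dyck path at its vertex \<open>r \<le> 2 * n\<close> shows that exactly
  \<open>W r 0 d * W (2 * n - r) d 0\<close> paths of semilength \<open>n\<close> have height \<open>d\<close> there, so that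
  \[ P(\mbox{height } d) = W(r,0,d) \cdot \frac{W(2n-r,d,0)}{W(2n,0,0)}. \]
  Only the fraction depends on \<open>n\<close>.  By the ballot formula its factors are quotients of factorials,
  successive ratios tend to simple constants, and the fraction tends to \<open>(d + 1) / 2 ^ r\<close> if
  \<open>r + d\<close> is even.  If \<open>r + d\<close> is odd, then \<open>W r 0 d = 0\<close>.  In all cases
  \<open>p r d = (d + 1) * W r 0 d / 2 ^ r\<close>; this is \<open>height_prob_limit\<close>.

  It remains to sum up.  Put \<open>s = sqrt (1 - x^2)\<close> and \<open>u = 1 / (1 + s)\<close> (\<open>sqrt_fps\<close>, \<open>recip_fps\<close>), so that
  \<open>x^2 * u = 1 - s\<close> and \<open>2 * u = 1 + x^2 * u^2\<close>.  The last identity says precisely that the series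
  \<open>2 * x^d * u^(d + 1)\<close> satisfy the recurrence that a last-step decomposition gives for
  \<open>\<Sum>r. W r 0 d * (x / 2)^r\<close>; hence the two agree (\<open>height_fps_nth\<close>).  Therefore
  \[ \sum_{r,d} p_{r,d} x^r y^d = \sum_d (d+1) \, 2 x^d u^{d+1} y^d = \frac{2u}{(1-xyu)^2}, \]
  and \<open>(1 - x*y*u)^2 / u = (1 + s) - 2*x*y + (1 - s) * y^2\<close> is the denominator of the theorem.  The
  formal verification (\<open>denominator_times_gf\<close>) multiplies by this quadratic polynomial in \<open>y\<close> and
  compares coefficients: the product has \<open>y^d\<close>-coefficient
  \<open>2 * x^d * u^d * ((d + 1) - 2*d + (d - 1)) = 0\<close> for \<open>d \<ge> 2\<close>.
\<close>

section \<open>Counting nonnegative walks\<close>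

fun walk_count :: "nat \<Rightarrow> nat \<Rightarrow> nat \<Rightarrow> nat" where
  "walk_count 0 b d = (if b = d then 1 else 0)"
| "walk_count (Suc m) b d =
     walk_count m (Suc b) d + (if b = 0 then 0 else walk_count m (b - 1) d)"

text \<open>
  The definition splits off the first step, which suits the recursion on vertex lists; the generating
  function in the end height needs the last step instead.
\<close>

lemma walk_count_last_step:
  "walk_count (Suc m) b d =
     walk_count m b (Suc d) + (if d = 0 then 0 else walk_count m b (d - 1))"
proof (induction m arbitrary: b)
  case 0
  show ?case by auto
next
  case (Suc m)
  have "walk_count (Suc (Suc m)) b d =
      walk_count (Suc m) (Suc b) d + (if b = 0 then 0 else walk_count (Suc m) (b - 1) d)"
    by (rule walk_count.simps)
  also have "\<dots> = walk_count (Suc m) b (Suc d) + (if d = 0 then 0 else walk_count (Suc m) b (d - 1))"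
    unfolding Suc.IH by simp
  finally show ?case .
qed

lemma walk_count_eq_0_parity:
  assumes "odd (m + b + d)"
  shows "walk_count m b d = 0"
  using assms
proof (induction m arbitrary: b)
  case 0
  then show ?case by (cases "b = d") simp_all
next
  case (Suc m)
  have "walk_count m (Suc b) d = 0" using Suc.prems by (intro Suc.IH) simp
  moreover have "walk_count m (b - 1) d = 0" if "b \<noteq> 0"
    using Suc.prems that by (intro Suc.IH) (cases b; simp)
  ultimately show ?case by simp
qed

lemma walk_count_ground_eq_0:
  assumes "m < d"
  shows "walk_count m d 0 = 0"
  using assms
proof (induction m arbitrary: d)
  case 0
  then show ?case by simp
next
  case (Suc m)
  then show ?case using Suc.IH[of "Suc d"] Suc.IH[of "d - 1"] by simp
qed

text \<open>
  A walk of length \<open>2 * k + d\<close> from height \<open>d\<close> to the ground has \<open>k\<close> up-steps and \<open>k + d\<close> down-steps.  The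
  ballot number, stated without division, follows by induction on the length from the first-step
  recursion and \<open>k * (d + 2) + (d + k + 1) * d = (d + 1) * (2 * k + d)\<close>.
\<close>

lemma ballot_formula:
  "real (walk_count (2 * k + d) d 0) * fact k * fact (d + k + 1) = real (d + 1) * fact (2 * k + d)"
proof (induction "2 * k + d" arbitrary: k d)
  case 0
  then show ?case by simp
next
  case (Suc m)
  note m = \<open>Suc m = 2 * k + d\<close>
  have up: "real (walk_count m (Suc d) 0) * fact k * fact (d + k + 1) = real k * real (d + 2) * fact m"
  proof (cases k)
    case 0
    then show ?thesis using m walk_count_ground_eq_0[of m "Suc d"] by simp
  next
    case (Suc l)
    have "m = 2 * l + Suc d" using m Suc by simp
    then have IH: "real (walk_count m (Suc d) 0) * fact l * fact (Suc d + l + 1)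
        = real (Suc d + 1) * fact m"
      using Suc.hyps(1)[of l "Suc d"] by simp
    have "real (walk_count m (Suc d) 0) * fact k * fact (d + k + 1)
        = real k * (real (walk_count m (Suc d) 0) * fact l * fact (Suc d + l + 1))"
      using Suc by simp
    then show ?thesis unfolding IH by simp
  qed
  have down: "real (if d = 0 then 0 else walk_count m (d - 1) 0) * fact k * fact (d + k + 1)
      = real (d + k + 1) * real d * fact m"
  proof (cases d)
    case 0
    then show ?thesis by simp
  next
    case (Suc e)
    have "m = 2 * k + e" using m Suc by simp
    then have IH: "real (walk_count m e 0) * fact k * fact (e + k + 1) = real (e + 1) * fact m"
      using Suc.hyps(1)[of k e] by simp
    have "real (walk_count m e 0) * fact k * fact (d + k + 1)
        = real (d + k + 1) * (real (walk_count m e 0) * fact k * fact (e + k + 1))"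
      using Suc by simp
    then show ?thesis unfolding IH using Suc by simp
  qed
  have "real (walk_count (Suc m) d 0) * fact k * fact (d + k + 1)
      = real k * real (d + 2) * fact m + real (d + k + 1) * real d * fact m"
    unfolding walk_count.simps of_nat_add distrib_right up down ..
  also have "\<dots> = real (d + 1) * (real (2 * k + d) * fact m)"
    by (simp add: algebra_simps)
  also have "real (2 * k + d) * fact m = fact (2 * k + d)"
    unfolding m[symmetric] by simp
  finally show ?case unfolding m .
qed

lemma ballot_quotient:
  "real (walk_count (2 * k + d) d 0) =
     real (d + 1) * fact (2 * k + d) / (fact k * fact (d + k + 1))"
  by (subst ballot_formula[symmetric]) simp

lemma walk_count_ground_nonzero: "walk_count (2 * k + d) d 0 \<noteq> 0"
proof
  assume "walk_count (2 * k + d) d 0 = 0"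
  then have "real (d + 1) * fact (2 * k + d) = 0" using ballot_formula[of k d] by simp
  then show False by simp
qed

lemma excursion_count_nonzero: "walk_count (2 * k) 0 0 \<noteq> 0"
  using walk_count_ground_nonzero[of k 0] by simp

section \<open>Counting Dyck paths through a given vertex\<close>

text \<open>
  Dyck paths generalized to an arbitrary starting vertex \<open>(a, b)\<close> with \<open>b \<ge> 0\<close>, a family closed under
  removing the first vertex.
\<close>

definition paths_to_ground :: "nat \<Rightarrow> int \<Rightarrow> nat \<Rightarrow> (int \<times> int) list set" where
  "paths_to_ground m a b = {P. length P = Suc m \<and> P \<noteq> [] \<and> hd P = (a, int b) \<and> last P = (a + int m, 0) \<and>
     successively (\<lambda>u v. v - u \<in> {(1, 1), (1, -1)}) P \<and> (\<forall>v \<in> set P. 0 \<le> snd v)}"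

lemma dyck_paths_eq_paths_to_ground: "dyck_paths n = paths_to_ground (2 * n) 0 0"
proof -
  have "P \<in> paths_to_ground (2 * n) 0 0" if "P \<in> dyck_paths n" for P
    using that dyck_paths_length[OF that]
    by (auto simp: dyck_paths_def paths_to_ground_def successively_conv_nth)
  moreover have "P \<in> dyck_paths n" if "P \<in> paths_to_ground (2 * n) 0 0" for P
    using that by (auto simp: dyck_paths_def paths_to_ground_def successively_conv_nth)
  ultimately show ?thesis by blast
qed

lemma paths_to_ground_0: "paths_to_ground 0 a b = (if b = 0 then {[(a, 0)]} else {})"
  by (auto simp: paths_to_ground_def length_Suc_conv)

lemma paths_to_ground_Suc:
  "paths_to_ground (Suc m) a b = Cons (a, int b) `
     (paths_to_ground m (a + 1) (Suc b) \<union> (if b = 0 then {} else paths_to_ground m (a + 1) (b - 1)))"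
  (is "?L = ?R")
proof (intro equalityI subsetI)
  fix P assume P: "P \<in> ?L"
  then obtain w Q where PQ: "P = (a, int b) # w # Q"
    by (cases P rule: remdups_adj.cases) (auto simp: paths_to_ground_def)
  have w: "w = (a + 1, int b + 1) \<or> w = (a + 1, int b - 1)" "snd w \<ge> 0"
    using P unfolding PQ by (cases w; force simp: paths_to_ground_def)+
  then have "hd (w # Q) = (a + 1, int (Suc b)) \<or> b \<noteq> 0 \<and> hd (w # Q) = (a + 1, int (b - 1))"
    by auto
  then have "w # Q \<in> paths_to_ground m (a + 1) (Suc b) \<union>
      (if b = 0 then {} else paths_to_ground m (a + 1) (b - 1))"
    using P unfolding PQ by (auto simp: paths_to_ground_def)
  then show "P \<in> ?R" unfolding PQ by blast
next
  fix P assume "P \<in> ?R"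
  then obtain Q where Q: "P = (a, int b) # Q"
    "Q \<in> paths_to_ground m (a + 1) (Suc b) \<or> b \<noteq> 0 \<and> Q \<in> paths_to_ground m (a + 1) (b - 1)"
    by (auto split: if_splits)
  then show "P \<in> ?L"
    by (cases Q) (auto simp: paths_to_ground_def)
qed

lemma finite_paths_to_ground: "finite (paths_to_ground m a b)"
  by (induction m arbitrary: a b) (simp_all add: paths_to_ground_0 paths_to_ground_Suc)

lemma disjoint_paths_to_ground:
  assumes "b \<noteq> c"
  shows "paths_to_ground m a b \<inter> paths_to_ground m a c = {}"
  using assms by (auto simp: paths_to_ground_def)

text \<open>
  The predicate \<open>\<phi>\<close> allows the same first-step decomposition to count all paths and those with a
  prescribed height at one vertex.
\<close>

lemma card_paths_to_ground_Suc:
  "card {P \<in> paths_to_ground (Suc m) a b. \<phi> P} =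
     card {Q \<in> paths_to_ground m (a + 1) (Suc b). \<phi> ((a, int b) # Q)} +
     (if b = 0 then 0 else card {Q \<in> paths_to_ground m (a + 1) (b - 1). \<phi> ((a, int b) # Q)})"
proof -
  let ?U = "{Q \<in> paths_to_ground m (a + 1) (Suc b). \<phi> ((a, int b) # Q)}"
  let ?D = "if b = 0 then {} else {Q \<in> paths_to_ground m (a + 1) (b - 1). \<phi> ((a, int b) # Q)}"
  have "{P \<in> paths_to_ground (Suc m) a b. \<phi> P} = Cons (a, int b) ` (?U \<union> ?D)"
    unfolding paths_to_ground_Suc by auto
  then have "card {P \<in> paths_to_ground (Suc m) a b. \<phi> P} = card (?U \<union> ?D)"
    by (simp add: card_image)
  also have "\<dots> = card ?U + card ?D"
    using disjoint_paths_to_ground[of "Suc b" "b - 1" m "a + 1"]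
    by (intro card_Un_disjoint) (auto simp: finite_paths_to_ground disjoint_iff split: if_splits)
  finally show ?thesis by auto
qed

lemma card_paths_to_ground: "card (paths_to_ground m a b) = walk_count m b 0"
proof (induction m arbitrary: a b)
  case 0
  show ?case by (simp add: paths_to_ground_0)
next
  case (Suc m)
  show ?case using card_paths_to_ground_Suc[of m a b "\<lambda>_. True"] by (simp add: Suc.IH)
qed

text \<open>
  The product formula for cutting a path at vertex \<open>r\<close>.  Peeling off first vertices reduces \<open>r\<close> to \<open>0\<close>,
  which spares an explicit bijection between paths and pairs of pieces.
\<close>

lemma card_paths_to_ground_through:
  assumes "r \<le> m"
  shows "card {P \<in> paths_to_ground m a b. snd (P ! r) = int d} =
     walk_count r b d * walk_count (m - r) d 0"
  using assms
proof (induction r arbitrary: m a b)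
  case 0
  have "{P \<in> paths_to_ground m a b. snd (P ! 0) = int d} =
      (if b = d then paths_to_ground m a b else {})"
    by (auto simp: paths_to_ground_def hd_conv_nth)
  then show ?case by (simp add: card_paths_to_ground)
next
  case (Suc r)
  then obtain k where k: "m = Suc k" "r \<le> k" by (cases m) auto
  show ?case unfolding k card_paths_to_ground_Suc using Suc.IH k
    by (simp add: distrib_right)
qed

lemma height_prob_eq:
  assumes "r \<le> 2 * n"
  shows "height_prob n r d =
     real (walk_count r 0 d) * (real (walk_count (2 * n - r) d 0) / real (walk_count (2 * n) 0 0))"
proof -
  have "height_prob n r d = real (card (dyck_paths n \<inter> {P. snd (P ! r) = int d})) / real (card (dyck_paths n))"
    unfolding height_prob_def by (rule measure_pmf_of_set[OF dyck_paths_nonempty finite_dyck_paths])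
  also have "dyck_paths n \<inter> {P. snd (P ! r) = int d} =
      {P \<in> paths_to_ground (2 * n) 0 0. snd (P ! r) = int d}"
    unfolding dyck_paths_eq_paths_to_ground by blast
  finally show ?thesis
    unfolding card_paths_to_ground_through[OF assms] dyck_paths_eq_paths_to_ground card_paths_to_ground
    by simp
qed

section \<open>The limiting probabilities\<close>

text \<open>
  Numerator and denominator of \<open>W (2 * n - r) d 0 / W (2 * n) 0 0\<close> are both reached from a common
  \<open>W (2 * k) 0 0\<close>: the numerator by raising the height, the denominator by lengthening the walk.  The
  next two lemmas compute one such step, whose factor tends to a constant.
\<close>

lemma walk_count_ratio_up:
  "real (walk_count (2 * k + Suc d) (Suc d) 0) / real (walk_count (2 * k + d) d 0) =
     real (d + 2) / real (d + 1) * (real (2 * k + d + 1) / real (d + k + 2))"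
proof -
  define A :: real where "A = fact (2 * k + d)"
  define B :: real where "B = fact k"
  define C :: real where "C = fact (d + k + 1)"
  have nz: "A \<noteq> 0" "B \<noteq> 0" "C \<noteq> 0" by (simp_all add: A_def B_def C_def)
  have A: "fact (2 * k + Suc d) = real (2 * k + d + 1) * A"
    and C: "fact (Suc d + k + 1) = real (d + k + 2) * C"
    by (simp_all add: A_def C_def)
  show ?thesis
    unfolding ballot_quotient A C A_def[symmetric] B_def[symmetric] C_def[symmetric]
    using nz by (simp add: divide_simps del: of_nat_add)
qed

lemma walk_count_ratio_excursions:
  "real (walk_count (2 * Suc k) 0 0) / real (walk_count (2 * k) 0 0) = 2 * real (2 * k + 1) / real (k + 2)"
proof -
  define A :: real where "A = fact (2 * k)"
  define B :: real where "B = fact k"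
  have nz: "A \<noteq> 0" "B \<noteq> 0" by (simp_all add: A_def B_def)
  have quot: "real (walk_count (2 * k) 0 0) = fact (2 * k) / (fact k * fact (k + 1))" for k
    using ballot_quotient[of k 0] by simp
  have A: "fact (2 * Suc k) = real (2 * k + 2) * (real (2 * k + 1) * A)"
    by (simp add: A_def)
  have B: "fact (k + 1) = real (k + 1) * B" "fact (Suc k) = real (k + 1) * B"
    "fact (Suc k + 1) = real (k + 2) * (real (k + 1) * B)"
    by (simp_all add: B_def)
  have two: "real (2 * k + 2) = 2 * real (k + 1)" by simp
  show ?thesis
    unfolding quot A B two A_def[symmetric] B_def[symmetric]
    using nz by (simp add: divide_simps) (simp add: algebra_simps)
qed

lemma walk_count_height_limit:
  "(\<lambda>k. real (walk_count (2 * k + d) d 0) / real (walk_count (2 * k) 0 0)) \<longlonglongrightarrow> real (d + 1) * 2 ^ d"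
proof (induction d)
  case 0
  show ?case by (simp add: excursion_count_nonzero)
next
  case (Suc d)
  have "(\<lambda>k. real (2 * k + d + 1) / real (d + k + 2)) \<longlonglongrightarrow> 2"
    by real_asymp
  from tendsto_mult[OF tendsto_mult[OF tendsto_const[of "real (d + 2) / real (d + 1)"] this] Suc]
  have "(\<lambda>k. real (walk_count (2 * k + Suc d) (Suc d) 0) / real (walk_count (2 * k + d) d 0) *
        (real (walk_count (2 * k + d) d 0) / real (walk_count (2 * k) 0 0)))
      \<longlonglongrightarrow> real (d + 2) / real (d + 1) * 2 * (real (d + 1) * 2 ^ d)"
    unfolding walk_count_ratio_up .
  moreover have "real (d + 2) / real (d + 1) * 2 * (real (d + 1) * 2 ^ d) = real (Suc d + 1) * 2 ^ Suc d"
    by (simp add: field_simps)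
  moreover have "real (walk_count (2 * k + Suc d) (Suc d) 0) / real (walk_count (2 * k + d) d 0) *
        (real (walk_count (2 * k + d) d 0) / real (walk_count (2 * k) 0 0)) =
      real (walk_count (2 * k + Suc d) (Suc d) 0) / real (walk_count (2 * k) 0 0)" for k
    using walk_count_ground_nonzero[of k d] by (simp del: walk_count.simps)
  ultimately show ?case by (simp only:)
qed

lemma walk_count_excursions_limit:
  "(\<lambda>k. real (walk_count (2 * (k + j)) 0 0) / real (walk_count (2 * k) 0 0)) \<longlonglongrightarrow> 4 ^ j"
proof (induction j)
  case 0
  show ?case by (simp add: excursion_count_nonzero)
next
  case (Suc j)
  have "(\<lambda>k. 2 * real (2 * (k + j) + 1) / real (k + j + 2)) \<longlonglongrightarrow> 4"
    by real_asymp
  from tendsto_mult[OF this Suc]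
  have "(\<lambda>k. real (walk_count (2 * Suc (k + j)) 0 0) / real (walk_count (2 * (k + j)) 0 0) *
        (real (walk_count (2 * (k + j)) 0 0) / real (walk_count (2 * k) 0 0))) \<longlonglongrightarrow> 4 * 4 ^ j"
    unfolding walk_count_ratio_excursions .
  moreover have "real (walk_count (2 * Suc (k + j)) 0 0) / real (walk_count (2 * (k + j)) 0 0) *
        (real (walk_count (2 * (k + j)) 0 0) / real (walk_count (2 * k) 0 0)) =
      real (walk_count (2 * Suc (k + j)) 0 0) / real (walk_count (2 * k) 0 0)" for k
    using excursion_count_nonzero[of "k + j"] by (simp del: walk_count.simps)
  ultimately show ?case by (simp only: add_Suc_right power_Suc)
qed

text \<open>
  For \<open>r + d = 2 * j\<close> and \<open>n = k + j\<close> the remaining length \<open>2 * n - r\<close> is \<open>2 * k + d\<close>, and the limit of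
  the fraction is \<open>(d + 1) * 2 ^ d / 4 ^ j = (d + 1) / 2 ^ r\<close>.
\<close>

lemma height_prob_limit:
  "(\<lambda>n. height_prob n r d) \<longlonglongrightarrow> real (walk_count r 0 d) * (real (d + 1) / 2 ^ r)"
proof (cases "even (r + d)")
  case True
  then obtain j where j: "r + d = 2 * j" by (elim evenE)
  have "(\<lambda>k. real (walk_count r 0 d) *
        (real (walk_count (2 * k + d) d 0) / real (walk_count (2 * k) 0 0) /
         (real (walk_count (2 * (k + j)) 0 0) / real (walk_count (2 * k) 0 0))))
      \<longlonglongrightarrow> real (walk_count r 0 d) * (real (d + 1) * 2 ^ d / 4 ^ j)"
    by (intro tendsto_mult tendsto_const tendsto_divide walk_count_height_limit
        walk_count_excursions_limit) simp
  moreover have "real (walk_count r 0 d) *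
        (real (walk_count (2 * k + d) d 0) / real (walk_count (2 * k) 0 0) /
         (real (walk_count (2 * (k + j)) 0 0) / real (walk_count (2 * k) 0 0)))
      = height_prob (k + j) r d" for k
  proof -
    have r: "r \<le> 2 * (k + j)" using j by simp
    have "2 * (k + j) - r = 2 * k + d" using j by simp
    with height_prob_eq[OF r, of d] have "height_prob (k + j) r d = real (walk_count r 0 d) *
        (real (walk_count (2 * k + d) d 0) / real (walk_count (2 * (k + j)) 0 0))"
      by (simp only:)
    then show ?thesis using excursion_count_nonzero[of k] by (simp del: walk_count.simps)
  qed
  moreover have "real (d + 1) * 2 ^ d / 4 ^ j = real (d + 1) / 2 ^ r"
  proof -
    have "(4 :: real) ^ j = 2 ^ (r + d)" unfolding j power_mult by simp
    then show ?thesis by (simp add: power_add)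
  qed
  ultimately have "(\<lambda>k. height_prob (k + j) r d) \<longlonglongrightarrow> real (walk_count r 0 d) * (real (d + 1) / 2 ^ r)"
    by (simp only:)
  then show ?thesis by (rule LIMSEQ_offset)
next
  case False
  then have 0: "walk_count r 0 d = 0" by (intro walk_count_eq_0_parity) simp
  have "eventually (\<lambda>n. height_prob n r d = 0) sequentially"
    using eventually_ge_at_top[of r] by eventually_elim (simp add: height_prob_eq 0)
  then show ?thesis using 0 by (simp add: tendsto_eventually)
qed

section \<open>The generating function\<close>

definition sqrt_fps :: "real fps" where
  "sqrt_fps = fps_radical root 2 (1 - fps_X ^ 2)"

lemma sqrt_one_minus_x2_eq: "sqrt_one_minus_x2 = fps_const sqrt_fps"
  unfolding sqrt_one_minus_x2_def sqrt_fps_def ..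

lemma sqrt_fps_nth_0: "fps_nth sqrt_fps 0 = 1"
  by (simp add: sqrt_fps_def)

definition recip_fps :: "real fps" where
  "recip_fps = inverse (1 + sqrt_fps)"

lemma recip_fps_mult: "(1 + sqrt_fps) * recip_fps = 1"
  unfolding recip_fps_def by (rule inverse_mult_eq_1') (simp add: sqrt_fps_nth_0)

lemma X2_recip_fps: "fps_X ^ 2 * recip_fps = 1 - sqrt_fps"
proof -
  have "fps_const (sqrt_fps ^ 2) = fps_const (1 - fps_X ^ 2)"
    using sqrt_one_minus_x2_square unfolding sqrt_one_minus_x2_eq var_x_def
    by (simp add: fps_const_power flip: fps_const_1_eq_1 fps_const_sub)
  then have "fps_X ^ 2 = (1 - sqrt_fps) * (1 + sqrt_fps)"
    by (simp add: algebra_simps power2_eq_square)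
  then have "fps_X ^ 2 * recip_fps = (1 - sqrt_fps) * ((1 + sqrt_fps) * recip_fps)"
    by (simp only: mult.assoc)
  then show ?thesis unfolding recip_fps_mult by simp
qed

text \<open>
  The functional equation of the generating function of the Catalan numbers:
  \<open>2 * recip_fps\<close> is \<open>\<Sum>r. W r 0 0 * (x / 2)^r\<close>.
\<close>

lemma recip_fps_equation: "2 * recip_fps = 1 + fps_X ^ 2 * recip_fps ^ 2"
proof -
  have "1 + fps_X ^ 2 * recip_fps ^ 2 = (1 + sqrt_fps) * recip_fps + (1 - sqrt_fps) * recip_fps"
    unfolding recip_fps_mult X2_recip_fps[symmetric] by (simp add: power2_eq_square)
  also have "\<dots> = 2 * recip_fps" by (simp add: algebra_simps)
  finally show ?thesis ..
qed

text \<open>The closed form of \<open>\<Sum>r. W r 0 d * (x / 2)^r\<close>, as \<open>height_fps_nth\<close> will show.\<close>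

definition height_fps :: "nat \<Rightarrow> real fps" where
  "height_fps d = 2 * fps_X ^ d * recip_fps ^ Suc d"

lemma height_fps_0: "height_fps 0 = 1 + fps_X * (fps_const (1/2) * height_fps 1)"
proof -
  have "fps_X * (fps_const (1/2) * height_fps 1) = (fps_const (1/2) * 2) * (fps_X ^ 2 * recip_fps ^ 2)"
    by (simp add: height_fps_def power2_eq_square)
  also have "fps_const (1/2 :: real) * 2 = 1" by (simp add: fps_eq_iff numeral_fps_const)
  finally show ?thesis by (simp add: height_fps_def recip_fps_equation)
qed

lemma height_fps_Suc:
  "height_fps (Suc d) = fps_X * (fps_const (1/2) * (height_fps (Suc (Suc d)) + height_fps d))"
proof -
  have half: "fps_const (1/2 :: real) * 2 = 1" by (simp add: fps_eq_iff numeral_fps_const)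
  have "fps_X * (fps_const (1/2) * (height_fps (Suc (Suc d)) + height_fps d))
      = (fps_const (1/2) * 2) * (fps_X ^ Suc d * recip_fps ^ Suc d * (1 + fps_X ^ 2 * recip_fps ^ 2))"
    by (simp add: height_fps_def power2_eq_square algebra_simps)
  also have "\<dots> = height_fps (Suc d)"
    unfolding half recip_fps_equation[symmetric] by (simp add: height_fps_def algebra_simps)
  finally show ?thesis ..
qed

text \<open>
  Both sides obey the same recurrence.  It expresses the coefficient of \<open>x^(r + 1)\<close> by coefficients of
  \<open>x^r\<close> at neighbouring heights, so an induction on \<open>r\<close> for all heights at once suffices.
\<close>

lemma height_fps_nth: "fps_nth (height_fps d) r = real (walk_count r 0 d) / 2 ^ r"
proof (induction r arbitrary: d)
  case 0
  show ?case
    by (cases d) (simp add: height_fps_0, simp add: height_fps_def)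
next
  case (Suc r)
  note IH = Suc.IH
  show ?case
  proof (cases d)
    case 0
    then show ?thesis
      unfolding walk_count_last_step
      by (simp add: height_fps_0 IH)
  next
    case (Suc e)
    then show ?thesis
      unfolding walk_count_last_step
      by (simp add: height_fps_Suc[of e] IH add_divide_distrib)
  qed
qed

lemma bivariate_gf_limit_prob_nth:
  "fps_nth (bivariate_gf limit_prob) d = of_nat (Suc d) * height_fps d"
proof (rule fps_ext)
  fix r
  have "limit_prob r d = real (walk_count r 0 d) * (real (d + 1) / 2 ^ r)"
    unfolding limit_prob_def by (rule limI[OF height_prob_limit])
  then show "fps_nth (fps_nth (bivariate_gf limit_prob) d) r = fps_nth (of_nat (Suc d) * height_fps d) r"
    by (simp add: bivariate_gf_def height_fps_nth fps_mult_of_nat_nth del: of_nat_Suc)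
qed

text \<open>
  As a polynomial in \<open>y\<close> the denominator is \<open>(1 + s) - 2*x*y + (1 - s) * y^2\<close>.  Each of its three
  coefficients, up to the number \<open>2\<close> in the middle, turns the adjacent member of \<open>height_fps\<close> into
  the same series \<open>2 * x^d * u^d\<close>, and the weights \<open>d + 1\<close>, \<open>-2*d\<close>, \<open>d - 1\<close> add up to zero.
\<close>

lemma denominator_times_gf:
  "(1 + var_y ^ 2 - 2 * var_x * var_y + (1 - var_y ^ 2) * sqrt_one_minus_x2) * bivariate_gf limit_prob = 2"
  (is "?D * ?P = 2")
proof (rule fps_ext)
  fix d
  have c: "fps_const (1 + sqrt_fps) = 1 + fps_const sqrt_fps"
    "fps_const (1 - sqrt_fps) = 1 - fps_const sqrt_fps"
    "fps_const (2 * fps_X :: real fps) = 2 * fps_const fps_X"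
    by (simp_all add: numeral_fps_const flip: fps_const_add fps_const_sub fps_const_mult)
  have D: "?D = fps_const (1 + sqrt_fps) - fps_const (2 * fps_X) * fps_X + fps_const (1 - sqrt_fps) * fps_X ^ 2"
    unfolding c var_x_def var_y_def sqrt_one_minus_x2_eq by algebra
  have coeff: "fps_nth (?D * ?P) d = (1 + sqrt_fps) * fps_nth ?P d
      - 2 * fps_X * (if d = 0 then 0 else fps_nth ?P (d - 1))
      + (1 - sqrt_fps) * (if d < 2 then 0 else fps_nth ?P (d - 2))"
    unfolding D by (simp add: distrib_right left_diff_distrib mult.assoc fps_X_power_mult_nth)
  have top: "(1 + sqrt_fps) * height_fps e = 2 * fps_X ^ e * recip_fps ^ e" for e
  proof -
    have "(1 + sqrt_fps) * height_fps e = 2 * fps_X ^ e * recip_fps ^ e * ((1 + sqrt_fps) * recip_fps)"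
      by (simp add: height_fps_def algebra_simps)
    then show ?thesis unfolding recip_fps_mult by simp
  qed
  have mid: "fps_X * height_fps e = 2 * fps_X ^ Suc e * recip_fps ^ Suc e" for e
    by (simp add: height_fps_def)
  have bot: "(1 - sqrt_fps) * height_fps e = 2 * fps_X ^ Suc (Suc e) * recip_fps ^ Suc (Suc e)" for e
    unfolding X2_recip_fps[symmetric] by (simp add: height_fps_def power2_eq_square algebra_simps)
  \<comment> \<open>For \<open>d < 2\<close> the terms at \<open>d - 1\<close> or \<open>d - 2\<close> may be absent.  At \<open>d = 1\<close> the weight \<open>d - 1\<close>
    of the absent term is zero anyway; at \<open>d = 0\<close> the first term alone remains and gives \<open>2\<close>.\<close>
  consider "d = 0" | "d = 1" | e where "d = Suc (Suc e)"
    by (metis One_nat_def not0_implies_Suc)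
  then show "fps_nth (?D * ?P) d = fps_nth 2 d"
  proof cases
    case 1
    then show ?thesis unfolding coeff bivariate_gf_limit_prob_nth using top[of 0] by simp
  next
    case 2
    have "fps_nth (?D * ?P) d = 2 * ((1 + sqrt_fps) * height_fps 1) - 2 * (fps_X * height_fps 0)"
      unfolding coeff bivariate_gf_limit_prob_nth using 2 by (simp add: mult.left_commute mult.assoc)
    then show ?thesis
      unfolding top mid using 2 by (simp add: numeral_fps_const)
  next
    case 3
    define z where "z = 2 * fps_X ^ d * recip_fps ^ d"
    have "fps_nth (?D * ?P) d = of_nat (Suc d) * ((1 + sqrt_fps) * height_fps d)
        - 2 * of_nat d * (fps_X * height_fps (Suc e)) + of_nat (Suc e) * ((1 - sqrt_fps) * height_fps e)"
      unfolding coeff bivariate_gf_limit_prob_nth using 3 by (simp add: algebra_simps)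
    also have "\<dots> = of_nat (Suc d) * z - 2 * of_nat d * z + of_nat (Suc e) * z"
      unfolding top mid bot z_def 3 ..
    also have "\<dots> = 0" using 3 by (simp add: algebra_simps)
    finally show ?thesis using 3 by (simp add: numeral_fps_const)
  qed
qed

theorem theorem3p3:
  shows "(\<forall>r d. convergent (\<lambda>n. height_prob n r d)) \<and>
    bivariate_gf limit_prob =
      2 / (1 + var_y ^ 2 - 2 * var_x * var_y + (1 - var_y ^ 2) * sqrt_one_minus_x2)"
proof (intro conjI allI)
  fix r d
  show "convergent (\<lambda>n. height_prob n r d)"
    using height_prob_limit by (rule convergentI)
next
  let ?D = "1 + var_y ^ 2 - 2 * var_x * var_y + (1 - var_y ^ 2) * sqrt_one_minus_x2"
  have "?D * bivariate_gf limit_prob = ?D * (2 / ?D)"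
    unfolding denominator_times_gf denominator_divides ..
  moreover have "?D \<noteq> 0"
    using denominator_times_gf by auto
  ultimately show "bivariate_gf limit_prob = 2 / ?D"
    by (metis mult_left_cancel)
qed

end
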